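(* Let $O\subset\mathbb{R}^3$ be an octant and let $P\subset\mathbb{R}^3$ be any finite set of points. Then the points of $P$ can be colored with two colors such that any translate of $O$ that contains at least $12$ points of $P$ contains points of $P$ of both colors.
   Context: An octant in $\mathbb{R}^3$ is a translate of a set $\{(x_1,x_2,x_3)\in\mathbb{R}^3 : \varepsilon_i x_i\le 0 \text{ for } i=1,2,3\}$ with $\varepsilon_1,\varepsilon_2,\varepsilon_3\in\{-1,1\}$, or of the corresponding open set (all three inequalities strict). *)

theory Defs
  imports "HOL-Analysis.Analysis"
begin

definition closed_octant :: "real ^ 3 \<Rightarrow> (real ^ 3) set" where
  "closed_octant \<epsilon> = {x. \<forall>i. \<epsilon> $ i * x $ i \<le> 0}"

definition open_octant :: "real ^ 3 \<Rightarrow> (real ^ 3) set" where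
  "open_octant \<epsilon> = {x. \<forall>i. \<epsilon> $ i * x $ i < 0}"

definition is_translate_of :: "'a::ab_group_add set \<Rightarrow> 'a set \<Rightarrow> bool" where
  "is_translate_of T S \<longleftrightarrow> (\<exists>t. T = (\<lambda>x. t + x) ` S)"

definition is_octant :: "(real ^ 3) set \<Rightarrow> bool" where
  "is_octant O' \<longleftrightarrow> (\<exists>\<epsilon>. (\<forall>i. \<epsilon> $ i \<in> {-1, 1}) \<and>
     (is_translate_of O' (closed_octant \<epsilon>) \<or> is_translate_of O' (open_octant \<epsilon>)))"

end

theory Submission
  imports Defs
begin

text \<open>After reflecting the axes, a translate of the octant meets \<open>P\<close> in a planar quadrant
  (in the first two coordinates) intersected with an initial segment in the third coordinate, which
  plays the role of time. The points are inserted in this order, and a graph of pairs that must get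
  different colours is built online such that at every time each quadrant with 12 points contains an
  edge. Some of the present points are free: their colours can still be prescribed arbitrarily. The
  staircase is an antichain such that every other non-free point has an edge among the points below
  it, and of two consecutive gaps of the staircase at least one is spanned by an edge. As soon as four
  free points \<open>q1, \<dots>, q4\<close>, from left to right, lie in a quadrant that avoids the staircase,
  the edges \<open>q1 q2\<close> and \<open>q3 q4\<close> are added and \<open>q2, q3\<close> move to the staircase. Otherwise a
  quadrant without edges contains at most two staircase points, which leave room for at most
  \<open>3 * 3\<close> free points.\<close>

section \<open>Listing the smallest elements of a finite set\<close>

lemma obtain_least:
  fixes f :: "'a \<Rightarrow> 'b::linorder"
  assumes "finite A" "inj_on f A" "card A \<ge> Suc n"
  obtains a where "a \<in> A" "\<And>b. b \<in> A - {a} \<Longrightarrow> f a < f b" "card (A - {a}) \<ge> n"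
proof -
  have ne: "A \<noteq> {}" using assms by auto
  define a where "a = arg_min_on f A"
  have a: "a \<in> A" "\<And>b. b \<in> A \<Longrightarrow> f a \<le> f b"
    unfolding a_def using arg_min_if_finite[OF assms(1) ne, of f] by (auto simp: not_less)
  show thesis
  proof (rule that[of a])
    fix b assume "b \<in> A - {a}"
    then have "f a \<noteq> f b" "f a \<le> f b" using a assms(2) by (auto simp: inj_on_def)
    then show "f a < f b" by simp
  qed (use a assms in auto)
qed

lemma obtain_increasing4:
  fixes f :: "'a \<Rightarrow> 'b::linorder"
  assumes "finite A" "inj_on f A" "card A \<ge> 4"
  obtains a b c d where "a \<in> A" "b \<in> A" "c \<in> A" "d \<in> A" "f a < f b" "f b < f c" "f c < f d"
proof -
  obtain a where a: "a \<in> A" "\<And>e. e \<in> A - {a} \<Longrightarrow> f a < f e" "card (A - {a}) \<ge> 3"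
    using obtain_least[of A f 3] assms by auto
  obtain b where b: "b \<in> A - {a}" "\<And>e. e \<in> A - {a} - {b} \<Longrightarrow> f b < f e" "card (A - {a} - {b}) \<ge> 2"
    using obtain_least[of "A - {a}" f 2] assms a(3) by (auto intro: inj_on_subset)
  obtain c where c: "c \<in> A - {a} - {b}" "\<And>e. e \<in> A - {a} - {b} - {c} \<Longrightarrow> f c < f e"
    "card (A - {a} - {b} - {c}) \<ge> 1"
    using obtain_least[of "A - {a} - {b}" f 1] assms b(3) by (auto intro: inj_on_subset)
  obtain d where d: "d \<in> A - {a} - {b} - {c}"
    using c(3) by (metis card.empty equals0I not_one_le_zero)
  show thesis
    using that[of a b c d] a b c d by auto
qed

lemma obtain_increasing3:
  fixes f :: "'a \<Rightarrow> 'b::linorder"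
  assumes "finite A" "inj_on f A" "card A \<ge> 3"
  obtains a b c where "a \<in> A" "b \<in> A" "c \<in> A" "f a < f b" "f b < f c"
proof -
  obtain a where a: "a \<in> A" "\<And>e. e \<in> A - {a} \<Longrightarrow> f a < f e" "card (A - {a}) \<ge> 2"
    using obtain_least[of A f 2] assms by auto
  obtain b where b: "b \<in> A - {a}" "\<And>e. e \<in> A - {a} - {b} \<Longrightarrow> f b < f e" "card (A - {a} - {b}) \<ge> 1"
    using obtain_least[of "A - {a}" f 1] assms a(3) by (auto intro: inj_on_subset)
  obtain c where c: "c \<in> A - {a} - {b}"
    using b(3) by (metis card.empty equals0I not_one_le_zero)
  show thesis
    using that[of a b c] a b c by auto
qed

section \<open>Edges, quadrants and antichains in the plane\<close>

definition spanned :: "('a \<times> 'a) set \<Rightarrow> 'a set \<Rightarrow> bool" where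
  "spanned E V \<longleftrightarrow> (\<exists>(u, v) \<in> E. u \<in> V \<and> v \<in> V)"

lemma spannedI: "(u, v) \<in> E \<Longrightarrow> u \<in> V \<Longrightarrow> v \<in> V \<Longrightarrow> spanned E V"
  by (auto simp: spanned_def)

lemma spanned_mono: "spanned E V \<Longrightarrow> E \<subseteq> E' \<Longrightarrow> V \<subseteq> V' \<Longrightarrow> spanned E' V'"
  by (auto simp: spanned_def)

locale quadrants =
  fixes x y :: "'a \<Rightarrow> 'b::linorder"
begin

definition quad :: "'b \<Rightarrow> 'b \<Rightarrow> 'a set" where
  "quad a b = {p. x p \<le> a \<and> y p \<le> b}"

text \<open>Covers open and closed quadrants and half-planes at once: mixing the corners of
  \<open>p\<close> and \<open>q\<close> makes \<open>V\<close> the intersection of a lower set in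
  \<open>x\<close> and a lower set in \<open>y\<close>. Cutting a wedge by a half-plane leaves a
  wedge, which the counting of free points uses.\<close>

definition wedge :: "'a set \<Rightarrow> bool" where
  "wedge V \<longleftrightarrow> (\<forall>p \<in> V. \<forall>q \<in> V. quad (x p) (y q) \<subseteq> V)"

lemma mem_quad [simp]: "p \<in> quad a b \<longleftrightarrow> x p \<le> a \<and> y p \<le> b"
  by (simp add: quad_def)

lemma wedgeD: "wedge V \<Longrightarrow> p \<in> V \<Longrightarrow> q \<in> V \<Longrightarrow> quad (x p) (y q) \<subseteq> V"
  by (auto simp: wedge_def)

lemma wedge_Int: "wedge V \<Longrightarrow> wedge W \<Longrightarrow> wedge (V \<inter> W)"
  by (fastforce simp: wedge_def)

lemma wedge_x_less: "wedge {p. x p < a}" and wedge_y_less: "wedge {p. y p < a}"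
  by (auto simp: wedge_def)

text \<open>General position is not assumed. Since the comparisons are weak, points with equal
  \<open>x\<close> are comparable, so an antichain is strictly ordered by \<open>x\<close> and in
  reverse by \<open>y\<close>.\<close>

definition antichain :: "'a set \<Rightarrow> bool" where
  "antichain A \<longleftrightarrow> (\<forall>p \<in> A. \<forall>q \<in> A. x p \<le> x q \<longrightarrow> y p \<le> y q \<longrightarrow> p = q)"

lemma antichainD: "antichain A \<Longrightarrow> p \<in> A \<Longrightarrow> q \<in> A \<Longrightarrow> x p < x q \<Longrightarrow> y q < y p"
  unfolding antichain_def by (metis less_imp_le less_irrefl not_le)

lemma antichain_inj: "antichain A \<Longrightarrow> inj_on x A"
  unfolding antichain_def inj_on_def by (metis linear order_refl)

lemma antichain_subset: "antichain A \<Longrightarrow> B \<subseteq> A \<Longrightarrow> antichain B"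
  by (auto simp: antichain_def)

end

section \<open>The state of the construction and its counting bound\<close>

text \<open>\<open>D\<close>: inserted points, \<open>S\<close>: staircase, \<open>F\<close>: free points, \<open>E\<close>: edges. The disjunction in
  \<open>pairs\<close> is stated for arbitrary \<open>s'\<close>, which amounts to the nearest one in the staircase.\<close>

locale state = quadrants x y for x y :: "'a \<Rightarrow> 'b::linorder" +
  fixes D S F :: "'a set" and E :: "('a \<times> 'a) set"
  assumes finite_D: "finite D"
    and S_sub: "S \<subseteq> D" and F_sub: "F \<subseteq> D" and E_sub: "E \<subseteq> D \<times> D"
    and S_anti: "antichain S" and F_anti: "antichain F"
    and not_above: "\<And>s q. s \<in> S \<Longrightarrow> q \<in> F \<Longrightarrow> s \<notin> quad (x q) (y q)"
    and dead: "\<And>p. p \<in> D \<Longrightarrow> p \<notin> S \<Longrightarrow> p \<notin> F \<Longrightarrow> spanned E (quad (x p) (y p))"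
    and pairs: "\<And>s. s \<in> S \<Longrightarrow>
      (\<forall>s' \<in> S. x s' < x s \<longrightarrow> spanned E (quad (x s) (y s'))) \<or>
      (\<forall>s' \<in> S. x s < x s' \<longrightarrow> spanned E (quad (x s') (y s)))"
    and extend: "\<And>f :: 'a \<Rightarrow> bool. \<exists>c. (\<forall>q \<in> F. c q = f q) \<and> (\<forall>(u, v) \<in> E. c u \<noteq> c v)"
begin

text \<open>Excludes exactly the situation that triggers a promotion, which takes four free points;
  hence the bound 3.\<close>

definition stable :: bool where
  "stable \<longleftrightarrow> (\<forall>V. wedge V \<and> V \<inter> S = {} \<longrightarrow> card (V \<inter> F) \<le> 3)"

lemma finite_F: "finite F" and finite_S: "finite S"
  using finite_D F_sub S_sub finite_subset by auto

text \<open>Of three staircase points in a wedge, the middle one has a spanned gap towards one of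
  the other two, and that gap lies in the wedge.\<close>

lemma card_S_le_2:
  assumes "wedge V" "\<not> spanned E V"
  shows "card (V \<inter> S) \<le> 2"
proof (rule ccontr)
  assume "\<not> ?thesis"
  then have "card (V \<inter> S) \<ge> 3" by simp
  moreover have "finite (V \<inter> S)" "inj_on x (V \<inter> S)"
    using finite_S antichain_inj[OF S_anti] by (auto intro: inj_on_subset)
  ultimately obtain a b c where abc: "a \<in> V \<inter> S" "b \<in> V \<inter> S" "c \<in> V \<inter> S" "x a < x b" "x b < x c"
    using obtain_increasing3 by metis
  have "spanned E (quad (x b) (y a)) \<or> spanned E (quad (x c) (y b))"
    using pairs[of b] abc by auto
  moreover have "quad (x b) (y a) \<subseteq> V" "quad (x c) (y b) \<subseteq> V"
    using abc wedgeD[OF assms(1)] by auto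
  ultimately show False
    using assms(2) spanned_mono[OF _ order_refl] by blast
qed

text \<open>A point outside \<open>S\<close> and \<open>F\<close> brings its edge into
  \<open>V\<close>, so only \<open>S\<close> and \<open>F\<close> count. At most two staircase
  points cut \<open>V\<close> into at most three wedges that avoid \<open>S\<close> and cover the
  free points; stability gives 3 * 3 + 2 = 11.\<close>

lemma card_le_11:
  assumes stable "wedge V" "\<not> spanned E V"
  shows "card (V \<inter> D) \<le> 11"
proof -
  have le3: "card (W \<inter> F) \<le> 3" if "wedge W" "W \<inter> S = {}" for W
    using assms(1) that by (auto simp: stable_def)
  have VD: "V \<inter> D \<subseteq> (V \<inter> S) \<union> (V \<inter> F)"
    using dead wedgeD[OF assms(2)] assms(3) spanned_mono[OF _ order_refl] by blast
  have F9: "card (V \<inter> F) \<le> 9"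
  proof -
    consider "card (V \<inter> S) = 0" | "card (V \<inter> S) = 1" | "card (V \<inter> S) = 2"
      using card_S_le_2[OF assms(2,3)] by linarith
    then show ?thesis
    proof cases
      case 1
      then show ?thesis using le3[OF assms(2)] finite_S by simp
    next
      case 2
      then obtain s where s: "V \<inter> S = {s}" by (auto simp: card_1_singleton_iff)
      let ?A = "V \<inter> {p. x p < x s}" and ?B = "V \<inter> {p. y p < y s}"
      have "V \<inter> F \<subseteq> (?A \<inter> F) \<union> (?B \<inter> F)"
        using not_above[of s] s by fastforce
      then have "card (V \<inter> F) \<le> card ((?A \<inter> F) \<union> (?B \<inter> F))"
        using finite_F by (intro card_mono) auto
      also have "\<dots> \<le> card (?A \<inter> F) + card (?B \<inter> F)"
        by (rule card_Un_le)
      also have "card (?A \<inter> F) \<le> 3"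
        by (rule le3) (use s in \<open>auto intro: wedge_Int assms wedge_x_less\<close>)
      also have "card (?B \<inter> F) \<le> 3"
        by (rule le3) (use s in \<open>auto intro: wedge_Int assms wedge_y_less\<close>)
      finally show ?thesis by simp
    next
      case 3
      then obtain a b where ab: "V \<inter> S = {a, b}" "a \<noteq> b" by (auto simp: card_2_iff)
      have "\<exists>s t. V \<inter> S = {s, t} \<and> x s < x t"
        using ab antichain_inj[OF S_anti]
        by (metis IntD2 inj_on_def insertCI insert_commute linorder_neqE)
      then obtain s t where st: "V \<inter> S = {s, t}" "x s < x t" by blast
      then have "y t < y s"
        using antichainD[OF S_anti, of s t] by blast
      \<comment> \<open>Left of \<open>s\<close>, below \<open>t\<close>, and the pocket between
        them: each misses both staircase points, and a free point, being above neither, lies in one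
        of the three.\<close>
      let ?A = "V \<inter> {p. x p < x s}" and ?B = "V \<inter> {p. y p < y t}"
      let ?C = "V \<inter> ({p. x p < x t} \<inter> {p. y p < y s})"
      have "W \<inter> S = {}" if "W \<subseteq> V" "s \<notin> W" "t \<notin> W" for W
      proof -
        have "W \<inter> S \<subseteq> {s, t}" using that(1) st(1) by blast
        then show ?thesis using that(2,3) by auto
      qed
      then have disj: "?A \<inter> S = {}" "?B \<inter> S = {}" "?C \<inter> S = {}"
        using st(2) \<open>y t < y s\<close> by (simp_all add: not_less less_imp_le)
      have "V \<inter> F \<subseteq> (?A \<inter> F) \<union> ((?B \<inter> F) \<union> (?C \<inter> F))"
      proof
        fix q assume q: "q \<in> V \<inter> F"
        then have "s \<notin> quad (x q) (y q)" "t \<notin> quad (x q) (y q)"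
          using not_above st by blast+
        with q show "q \<in> (?A \<inter> F) \<union> ((?B \<inter> F) \<union> (?C \<inter> F))" by auto
      qed
      then have "card (V \<inter> F) \<le> card ((?A \<inter> F) \<union> ((?B \<inter> F) \<union> (?C \<inter> F)))"
        using finite_F by (intro card_mono) auto
      also have "\<dots> \<le> card (?A \<inter> F) + (card (?B \<inter> F) + card (?C \<inter> F))"
        by (meson add_left_mono card_Un_le order_trans)
      also have "card (?A \<inter> F) \<le> 3"
        using disj(1) by (intro le3) (auto intro: wedge_Int assms wedge_x_less)
      also have "card (?B \<inter> F) \<le> 3"
        using disj(2) by (intro le3) (auto intro: wedge_Int assms wedge_y_less)
      also have "card (?C \<inter> F) \<le> 3"
        using disj(3) by (intro le3) (auto intro!: wedge_Int assms wedge_y_less wedge_x_less)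
      finally show ?thesis by simp
    qed
  qed
  have "card (V \<inter> D) \<le> card ((V \<inter> S) \<union> (V \<inter> F))"
    using VD finite_S finite_F by (intro card_mono) auto
  also have "\<dots> \<le> card (V \<inter> S) + card (V \<inter> F)" by (rule card_Un_le)
  finally show ?thesis
    using F9 card_S_le_2[OF assms(2,3)] by linarith
qed

section \<open>Insertion and promotion of points\<close>

text \<open>The new point has just one edge, to a point below it, so it can be coloured last,
  opposite to \<open>r\<close>.\<close>

lemma insert_dead:
  assumes "p \<notin> D" "r \<in> S \<union> F" "r \<in> quad (x p) (y p)"
  shows "state x y (insert p D) S F (insert (p, r) E)"
proof
  let ?E = "insert (p, r) E"
  have E: "spanned E V \<Longrightarrow> spanned ?E V" for V
    by (erule spanned_mono) auto
  show "spanned ?E (quad (x q) (y q))" if "q \<in> insert p D" "q \<notin> S" "q \<notin> F" for q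
    using that dead[of q] E spannedI[of p r ?E] assms(3) by (cases "q = p") auto
  show "(\<forall>s' \<in> S. x s' < x s \<longrightarrow> spanned ?E (quad (x s) (y s'))) \<or>
      (\<forall>s' \<in> S. x s < x s' \<longrightarrow> spanned ?E (quad (x s') (y s)))" if "s \<in> S" for s
    using pairs[OF that] E by blast
  show "\<exists>c. (\<forall>q \<in> F. c q = f q) \<and> (\<forall>(u, v) \<in> ?E. c u \<noteq> c v)" for f :: "'a \<Rightarrow> bool"
  proof -
    obtain c where c: "\<forall>q \<in> F. c q = f q" "\<forall>(u, v) \<in> E. c u \<noteq> c v" using extend by blast
    have "r \<noteq> p" using assms S_sub F_sub by blast
    have "\<forall>q \<in> F. (c(p := \<not> c r)) q = f q" using c(1) assms(1) F_sub by auto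
    moreover have "\<forall>(u, v) \<in> ?E. (c(p := \<not> c r)) u \<noteq> (c(p := \<not> c r)) v"
      using c(2) assms(1) E_sub \<open>r \<noteq> p\<close> by auto
    ultimately show ?thesis by blast
  qed
qed (use finite_D S_sub F_sub E_sub S_anti F_anti not_above assms in auto)

text \<open>With nothing below it, \<open>p\<close> becomes free. The free points above it are given
  up: joined to \<open>p\<close> by a star, they take the colour opposite to the one prescribed for
  \<open>p\<close>, which is possible because they were free until now.\<close>

lemma insert_free:
  assumes p: "p \<notin> D" and below: "\<And>r. r \<in> S \<union> F \<Longrightarrow> r \<notin> quad (x p) (y p)"
  defines "R \<equiv> {r \<in> F. p \<in> quad (x r) (y r)}"
  shows "state x y (insert p D) S (insert p (F - R)) (E \<union> {p} \<times> R)"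
proof
  let ?E = "E \<union> {p} \<times> R" and ?F = "insert p (F - R)"
  have E: "spanned E V \<Longrightarrow> spanned ?E V" for V
    by (erule spanned_mono) auto
  have R: "R \<subseteq> F" by (auto simp: R_def)
  show "antichain ?F"
    using F_anti below unfolding antichain_def R_def by auto
  show "s \<notin> quad (x q) (y q)" if "s \<in> S" "q \<in> ?F" for s q
    using that not_above below by auto
  show "spanned ?E (quad (x q) (y q))" if q: "q \<in> insert p D" "q \<notin> S" "q \<notin> ?F" for q
  proof (cases "q \<in> R")
    case True
    then show ?thesis by (intro spannedI[of p q]) (auto simp: R_def)
  next
    case False
    then show ?thesis using q dead[of q] E by auto
  qed
  show "(\<forall>s' \<in> S. x s' < x s \<longrightarrow> spanned ?E (quad (x s) (y s'))) \<or>
      (\<forall>s' \<in> S. x s < x s' \<longrightarrow> spanned ?E (quad (x s') (y s)))" if "s \<in> S" for s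
    using pairs[OF that] E by blast
  show "\<exists>c. (\<forall>q \<in> ?F. c q = f q) \<and> (\<forall>(u, v) \<in> ?E. c u \<noteq> c v)" for f :: "'a \<Rightarrow> bool"
  proof -
    obtain c where c: "\<forall>q \<in> F. c q = (if q \<in> R then \<not> f p else f q)" "\<forall>(u, v) \<in> E. c u \<noteq> c v"
      using extend[of "\<lambda>q. if q \<in> R then \<not> f p else f q"] by blast
    have "\<forall>q \<in> ?F. (c(p := f p)) q = f q" using c(1) by auto
    moreover have "\<forall>(u, v) \<in> ?E. (c(p := f p)) u \<noteq> (c(p := f p)) v"
      using c p E_sub F_sub R by auto
    ultimately show ?thesis by blast
  qed
qed (use finite_D S_sub F_sub E_sub S_anti p in \<open>auto simp: R_def\<close>)

lemma insert_point:
  assumes "p \<notin> D"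
  obtains F' E' where "state x y (insert p D) S F' E'" "E \<subseteq> E'"
proof (cases "\<exists>r \<in> S \<union> F. r \<in> quad (x p) (y p)")
  case True
  then show thesis using insert_dead[OF assms] that by blast
next
  case False
  then show thesis using insert_free[OF assms] that by blast
qed

text \<open>A staircase point above \<open>q2\<close> or \<open>q3\<close> lies outside the quadrant spanned by \<open>q1\<close> and
  \<open>q4\<close>, hence above both ends of one of the new edges. There is no edge between \<open>q2\<close> and \<open>q3\<close>,
  so that \<open>q1\<close> and \<open>q4\<close> stay independent and can remain free.\<close>

lemma promote:
  assumes q: "q1 \<in> F" "q2 \<in> F" "q3 \<in> F" "q4 \<in> F"
    and lt: "x q1 < x q2" "x q2 < x q3" "x q3 < x q4"
    and no_S: "quad (x q4) (y q1) \<inter> S = {}"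
  defines "R \<equiv> {s \<in> S. q2 \<in> quad (x s) (y s) \<or> q3 \<in> quad (x s) (y s)}"
  shows "state x y D (insert q2 (insert q3 (S - R))) (F - {q2, q3}) (insert (q1, q2) (insert (q3, q4) E))"
proof
  let ?S = "insert q2 (insert q3 (S - R))" and ?F = "F - {q2, q3}"
  let ?E = "insert (q1, q2) (insert (q3, q4) E)"
  have E: "spanned E V \<Longrightarrow> spanned ?E V" for V
    by (erule spanned_mono) auto
  have E12: "spanned ?E V" if "q1 \<in> V" "q2 \<in> V" for V using that by (auto intro: spannedI)
  have E34: "spanned ?E V" if "q3 \<in> V" "q4 \<in> V" for V using that by (auto intro: spannedI)
  have ylt: "y q2 < y q1" "y q3 < y q2" "y q4 < y q3"
    using antichainD[OF F_anti] q lt by blast+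
  have outside: "x q4 < x s \<or> y q1 < y s" if "s \<in> S" for s
    using no_S that by (auto simp: disjoint_iff) (meson not_le)
  have notS: "q2 \<notin> S" "q3 \<notin> S" using not_above[of q2 q2] not_above[of q3 q3] q by auto
  \<comment> \<open>A staircase point that stays is above neither \<open>q2\<close> nor
    \<open>q3\<close>, yet lies right of \<open>q4\<close> or above \<open>q1\<close>; this pushes
    it to one of the two far ends.\<close>
  have kept: "x s < x q2 \<and> y q1 < y s \<or> x q4 < x s \<and> y s < y q3" if s: "s \<in> S - R" for s
    using outside[of s] s lt ylt unfolding R_def by auto
  show "antichain ?S"
  proof -
    have "x q2 \<le> x q3 \<longrightarrow> y q2 \<le> y q3 \<longrightarrow> q2 = q3" "x q3 \<le> x q2 \<longrightarrow> y q3 \<le> y q2 \<longrightarrow> q3 = q2"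
      using lt ylt by auto
    moreover have "\<And>s q. s \<in> S - R \<Longrightarrow> q \<in> {q2, q3} \<Longrightarrow>
        (x s \<le> x q \<longrightarrow> y s \<le> y q \<longrightarrow> s = q) \<and> (x q \<le> x s \<longrightarrow> y q \<le> y s \<longrightarrow> q = s)"
      using kept lt ylt by force
    ultimately show ?thesis
      using S_anti unfolding antichain_def by blast
  qed
  show "antichain ?F" using F_anti antichain_subset by blast
  show "s \<notin> quad (x r) (y r)" if "s \<in> ?S" "r \<in> ?F" for s r
    using that not_above[of s r] F_anti q unfolding antichain_def by auto
  show "spanned ?E (quad (x p) (y p))" if p: "p \<in> D" "p \<notin> ?S" "p \<notin> ?F" for p
  proof (cases "p \<in> R")
    case True
    then have "q1 \<in> quad (x p) (y p) \<and> q2 \<in> quad (x p) (y p) \<or> q3 \<in> quad (x p) (y p) \<and> q4 \<in> quad (x p) (y p)"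
      using outside[of p] lt ylt unfolding R_def by auto
    then show ?thesis using E12 E34 by blast
  next
    case False
    then show ?thesis using p dead[of p] E by auto
  qed
  show "(\<forall>s' \<in> ?S. x s' < x s \<longrightarrow> spanned ?E (quad (x s) (y s'))) \<or>
      (\<forall>s' \<in> ?S. x s < x s' \<longrightarrow> spanned ?E (quad (x s') (y s)))" if s: "s \<in> ?S" for s
  proof -
    \<comment> \<open>A gap from an old point on the left contains \<open>q1\<close> and
      \<open>q2\<close>; symmetrically, one to an old point on the right contains \<open>q3\<close>
      and \<open>q4\<close>.\<close>
    have l: "spanned ?E (quad (x b) (y a))" if "a \<in> S - R" "b \<in> {q2, q3}" "x a < x b" for a b
      using that kept[of a] lt ylt by (intro E12) auto
    have r: "spanned ?E (quad (x b) (y a))" if "a \<in> {q2, q3}" "b \<in> S - R" "x a < x b" for a b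
      using that kept[of b] lt ylt by (intro E34) auto
    \<comment> \<open>The gap between \<open>q2\<close> and \<open>q3\<close> may stay unspanned:
      \<open>q2\<close> relies on its left side, \<open>q3\<close> on its right side. An old point
      keeps its good side, since gaps to the new points are spanned.\<close>
    consider "s = q2" | "s = q3" | "s \<in> S - R" using s by blast
    then show ?thesis
    proof cases
      case 1
      then show ?thesis using l lt by (intro disjI1) auto
    next
      case 2
      then show ?thesis using r lt by (intro disjI2) auto
    next
      case 3
      then show ?thesis using pairs[of s] l[OF 3] r[OF _ 3] E by blast
    qed
  qed
  show "\<exists>c. (\<forall>q \<in> ?F. c q = f q) \<and> (\<forall>(u, v) \<in> ?E. c u \<noteq> c v)" for f :: "'a \<Rightarrow> bool"
  proof -
    have ne: "q1 \<noteq> q2" "q1 \<noteq> q3" "q4 \<noteq> q2" "q4 \<noteq> q3" "q2 \<noteq> q3" using lt by auto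
    \<comment> \<open>Since \<open>q2\<close> and \<open>q3\<close> were free, they can be made to
      oppose \<open>q1\<close> and \<open>q4\<close>, whose colours remain arbitrary.\<close>
    obtain c where "\<forall>q \<in> F. c q = (f(q2 := \<not> f q1, q3 := \<not> f q4)) q" "\<forall>(u, v) \<in> E. c u \<noteq> c v"
      using extend[of "f(q2 := \<not> f q1, q3 := \<not> f q4)"] by blast
    then have "(\<forall>q \<in> ?F. c q = f q) \<and> (\<forall>(u, v) \<in> ?E. c u \<noteq> c v)"
      using q ne by auto
    then show ?thesis by blast
  qed
qed (use finite_D S_sub F_sub E_sub q in \<open>auto simp: R_def\<close>)

end

section \<open>The construction over time\<close>

context quadrants
begin

text \<open>Every promotion removes two free points and keeps all edges, so repeated promotion
  terminates.\<close>

lemma stabilise: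
  assumes "state x y D S F E"
  obtains S' F' E' where "state x y D S' F' E'" "state.stable x y S' F'" "E \<subseteq> E'"
  using assms
proof (induction "card F" arbitrary: S F E thesis rule: less_induct)
  case less
  interpret state x y D S F E by fact
  show ?case
  proof (cases stable)
    case True
    then show ?thesis using less.prems by blast
  next
    case False
    then obtain V where V: "wedge V" "V \<inter> S = {}" "card (V \<inter> F) \<ge> 4"
      by (auto simp: stable_def not_le)
    have "finite (V \<inter> F)" "inj_on x (V \<inter> F)"
      using finite_F antichain_inj[OF F_anti] by (auto intro: inj_on_subset)
    then obtain q1 q2 q3 q4 where q: "q1 \<in> V \<inter> F" "q2 \<in> V \<inter> F" "q3 \<in> V \<inter> F" "q4 \<in> V \<inter> F"
      and lt: "x q1 < x q2" "x q2 < x q3" "x q3 < x q4"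
      using obtain_increasing4 V(3) by metis
    have "quad (x q4) (y q1) \<inter> S = {}"
      using wedgeD[OF V(1), of q4 q1] q V(2) by blast
    then have *: "state x y D (insert q2 (insert q3 (S - {s \<in> S. q2 \<in> quad (x s) (y s) \<or> q3 \<in> quad (x s) (y s)})))
        (F - {q2, q3}) (insert (q1, q2) (insert (q3, q4) E))"
      using q lt by (intro promote) auto
    have "card (F - {q2, q3}) < card F"
      using q finite_F by (intro psubset_card_mono) auto
    then show ?thesis
    proof (rule less.hyps[OF _ _ *])
      fix S' F' E'
      assume "state x y D S' F' E'" "state.stable x y S' F'" "insert (q1, q2) (insert (q3, q4) E) \<subseteq> E'"
      then show thesis using less.prems(1)[of S' F' E'] by simp
    qed
  qed
qed

text \<open>The set \<open>U\<close> is the part inserted up to some height. Quantifying over all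
  \<open>U\<close> records the guarantee for every past moment; it survives because edges are never
  removed.\<close>

lemma dynamic_edges:
  fixes z :: "'a \<Rightarrow> 'c::linorder"
  assumes "finite D"
  shows "\<exists>S F E. state x y D S F E \<and> state.stable x y S F \<and>
    (\<forall>U V. U \<subseteq> D \<and> (\<forall>p \<in> U. \<forall>q \<in> D. z q \<le> z p \<longrightarrow> q \<in> U) \<and> wedge V \<and> card (V \<inter> U) \<ge> 12
      \<longrightarrow> spanned E (V \<inter> U))"
  using assms
proof (induction D rule: finite_ranking_induct[where f = z])
  case empty
  have st: "state x y {} {} {} {}"
    by unfold_locales (auto simp: antichain_def)
  then have "state.stable x y {} {}"
    by (simp add: state.stable_def)
  with st show ?case by (intro exI[of _ "{}"]) auto
next
  case (insert p D)
  show ?case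
  proof (cases "p \<in> D")
    case True
    then show ?thesis using insert.IH by (simp only: insert_absorb)
  next
    case p: False
    from insert.IH obtain S F E where st: "state x y D S F E"
      and old: "\<forall>U V. U \<subseteq> D \<and> (\<forall>p \<in> U. \<forall>q \<in> D. z q \<le> z p \<longrightarrow> q \<in> U) \<and> wedge V \<and>
        card (V \<inter> U) \<ge> 12 \<longrightarrow> spanned E (V \<inter> U)"
      by (elim exE conjE)
    obtain F1 E1 where st1: "state x y (insert p D) S F1 E1" "E \<subseteq> E1"
      using state.insert_point[OF st p] by metis
    obtain S' F' E' where st': "state x y (insert p D) S' F' E'" and sta: "state.stable x y S' F'"
      and "E1 \<subseteq> E'"
      using stabilise[OF st1(1)] by blast
    have "E \<subseteq> E'" using st1 \<open>E1 \<subseteq> E'\<close> by blast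
    interpret state x y "insert p D" S' F' E' by fact
    have "spanned E' (V \<inter> U)" if U: "U \<subseteq> insert p D" "\<forall>a \<in> U. \<forall>q \<in> insert p D. z q \<le> z a \<longrightarrow> q \<in> U"
      and V: "wedge V" "card (V \<inter> U) \<ge> 12" for U V
    proof (cases "p \<in> U")
      case True
      \<comment> \<open>The newest point has maximal \<open>z\<close>, so a lower set containing it
        is everything, and the bound of 11 for the current stable state applies.\<close>
      then have "U = insert p D" using U insert.hyps(2) by auto
      moreover from this have "spanned E' V"
        using card_le_11[OF sta V(1)] V(2) by (cases "spanned E' V") simp_all
      ultimately show ?thesis using E_sub by (auto simp: spanned_def)
    next
      case False
      then have "spanned E (V \<inter> U)" using U V by (intro old[rule_format] conjI) auto
      then show ?thesis using \<open>E \<subseteq> E'\<close> by (rule spanned_mono) auto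
    qed
    then show ?thesis using st' sta by blast
  qed
qed

lemma dynamic_colouring:
  fixes z :: "'a \<Rightarrow> 'c::linorder"
  assumes "finite P"
  obtains c :: "'a \<Rightarrow> bool"
  where "\<And>U V. U \<subseteq> P \<Longrightarrow> \<forall>p \<in> U. \<forall>q \<in> P. z q \<le> z p \<longrightarrow> q \<in> U \<Longrightarrow> wedge V \<Longrightarrow> card (V \<inter> U) \<ge> 12 \<Longrightarrow>
    (\<exists>p \<in> V \<inter> U. c p) \<and> (\<exists>q \<in> V \<inter> U. \<not> c q)"
proof -
  from dynamic_edges[OF assms, of z] obtain S F E where st: "state x y P S F E"
    and sp: "\<forall>U V. U \<subseteq> P \<and> (\<forall>p \<in> U. \<forall>q \<in> P. z q \<le> z p \<longrightarrow> q \<in> U) \<and> wedge V \<and>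
      card (V \<inter> U) \<ge> 12 \<longrightarrow> spanned E (V \<inter> U)"
    by (elim exE conjE)
  interpret state x y P S F E by fact
  \<comment> \<open>Any prescription on the free points will do; only properness on the edges
    matters now.\<close>
  obtain c :: "'a \<Rightarrow> bool" where c: "\<forall>(u, v) \<in> E. c u \<noteq> c v" using extend[of "\<lambda>_. True"] by blast
  show thesis
  proof (rule that[of c])
    fix U V assume "U \<subseteq> P" "\<forall>p \<in> U. \<forall>q \<in> P. z q \<le> z p \<longrightarrow> q \<in> U" "wedge V" "card (V \<inter> U) \<ge> 12"
    then have "spanned E (V \<inter> U)" by (intro sp[rule_format] conjI)
    then obtain u v where "(u, v) \<in> E" "u \<in> V \<inter> U" "v \<in> V \<inter> U" by (auto simp: spanned_def)
    then show "(\<exists>p \<in> V \<inter> U. c p) \<and> (\<exists>q \<in> V \<inter> U. \<not> c q)" using c by fastforce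
  qed
qed

end

section \<open>From octants to quadrants over time\<close>

text \<open>The offset of \<open>Oct\<close> itself and that of the translate add up, so all
  translates share one sign vector and differ only in their bounds.\<close>

lemma translate_octant:
  assumes "is_octant Oct"
  obtains \<epsilon> :: "real ^ 3" where
    "\<And>T. is_translate_of T Oct \<Longrightarrow>
      \<exists>a. T = {p. \<forall>i. \<epsilon> $ i * p $ i \<le> a i} \<or> T = {p. \<forall>i. \<epsilon> $ i * p $ i < a i}"
proof -
  obtain \<epsilon> t where Oct: "Oct = (\<lambda>x. t + x) ` closed_octant \<epsilon> \<or> Oct = (\<lambda>x. t + x) ` open_octant \<epsilon>"
    using assms by (auto simp: is_octant_def is_translate_of_def)
  show thesis
  proof (rule that[of \<epsilon>])
    fix T assume "is_translate_of T Oct"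
    then obtain t' where T: "T = (\<lambda>x. t' + x) ` Oct" by (auto simp: is_translate_of_def)
    have add_mem: "p \<in> (\<lambda>x. t' + x) ` (\<lambda>x. t + x) ` A \<longleftrightarrow> p - t' - t \<in> A" for p A
      by (force simp: image_iff algebra_simps)
    let ?a = "\<lambda>i. \<epsilon> $ i * (t' + t) $ i"
    from Oct have "T = {p. \<forall>i. \<epsilon> $ i * p $ i \<le> ?a i} \<or> T = {p. \<forall>i. \<epsilon> $ i * p $ i < ?a i}"
    proof
      assume Oct: "Oct = (\<lambda>x. t + x) ` closed_octant \<epsilon>"
      have "T = {p. \<forall>i. \<epsilon> $ i * p $ i \<le> ?a i}"
        unfolding T Oct set_eq_iff add_mem by (simp add: closed_octant_def algebra_simps)
      then show ?thesis ..
    next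
      assume Oct: "Oct = (\<lambda>x. t + x) ` open_octant \<epsilon>"
      have "T = {p. \<forall>i. \<epsilon> $ i * p $ i < ?a i}"
        unfolding T Oct set_eq_iff add_mem by (simp add: open_octant_def algebra_simps)
      then show ?thesis ..
    qed
    then show "\<exists>a. T = {p. \<forall>i. \<epsilon> $ i * p $ i \<le> a i} \<or> T = {p. \<forall>i. \<epsilon> $ i * p $ i < a i}"
      by (rule exI[of _ ?a])
  qed
qed

theorem theorem5:
  fixes Oct P :: "(real ^ 3) set"
  assumes "is_octant Oct" and "finite P"
  shows "\<exists>c :: real ^ 3 \<Rightarrow> bool. \<forall>T. is_translate_of T Oct \<and> card (T \<inter> P) \<ge> 12 \<longrightarrow>
           (\<exists>p \<in> T \<inter> P. c p) \<and> (\<exists>q \<in> T \<inter> P. \<not> c q)"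
proof -
  obtain \<epsilon> :: "real ^ 3" where T: "\<And>T. is_translate_of T Oct \<Longrightarrow>
      \<exists>a. T = {p. \<forall>i. \<epsilon> $ i * p $ i \<le> a i} \<or> T = {p. \<forall>i. \<epsilon> $ i * p $ i < a i}"
    using translate_octant[OF assms(1)] by blast
  define x y z where "x p = \<epsilon> $ 1 * p $ 1" and "y p = \<epsilon> $ 2 * p $ 2" and "z p = \<epsilon> $ 3 * p $ 3"
    for p :: "real ^ 3"
  interpret quadrants x y .
  obtain c where c: "\<And>U V. U \<subseteq> P \<Longrightarrow> \<forall>p \<in> U. \<forall>q \<in> P. z q \<le> z p \<longrightarrow> q \<in> U \<Longrightarrow> wedge V \<Longrightarrow>
      card (V \<inter> U) \<ge> 12 \<Longrightarrow> (\<exists>p \<in> V \<inter> U. c p) \<and> (\<exists>q \<in> V \<inter> U. \<not> c q)"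
    using dynamic_colouring[OF assms(2), of z] by blast
  have "(\<exists>p \<in> T \<inter> P. c p) \<and> (\<exists>q \<in> T \<inter> P. \<not> c q)"
    if T': "is_translate_of T Oct" "card (T \<inter> P) \<ge> 12" for T
  proof -
    obtain a where "T = {p. \<forall>i. \<epsilon> $ i * p $ i \<le> a i} \<or> T = {p. \<forall>i. \<epsilon> $ i * p $ i < a i}"
      using T[OF T'(1)] by blast
    \<comment> \<open>The first two inequalities give the wedge \<open>V\<close>, the third one the
      initial segment \<open>U\<close> of \<open>P\<close>; strict and weak bounds are treated
      alike.\<close>
    then obtain V U where "T \<inter> P = V \<inter> U" "U \<subseteq> P" "\<forall>p \<in> U. \<forall>q \<in> P. z q \<le> z p \<longrightarrow> q \<in> U" "wedge V"
    proof
      assume "T = {p. \<forall>i. \<epsilon> $ i * p $ i \<le> a i}"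
      then show thesis
        by (intro that[of "{p. x p \<le> a 1 \<and> y p \<le> a 2}" "{p \<in> P. z p \<le> a 3}"])
          (auto simp: x_def y_def z_def forall_3 wedge_def)
    next
      assume "T = {p. \<forall>i. \<epsilon> $ i * p $ i < a i}"
      then show thesis
        by (intro that[of "{p. x p < a 1 \<and> y p < a 2}" "{p \<in> P. z p < a 3}"])
          (auto simp: x_def y_def z_def forall_3 wedge_def)
    qed
    then show ?thesis using c T'(2) by metis
  qed
  then show ?thesis by blast
qed

end
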